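(* For all integers $k\ge0$ and $n\ge k+1$, \[ f_{112,221}(n,k)=\sum_{j=1}^{k} j\cdot j!\binom{k}{j}; \] for all integers $k\ge n\ge 2$, \[ f_{112,221}(n,k)=n!\binom{k}{n}+\sum_{j=1}^{n-1} j\cdot j!\binom{k}{j}; \] and $f_{112,221}(0,k)=1$, $f_{112,221}(1,k)=k$.
   Context: For integers $k,n\ge 0$, a word is an element of $[k]^n$, where $[k]=\{1,\dots,k\}$ is totally ordered. A pattern is a word $\tau\in[\ell]^m$ containing every letter $1,\dots,\ell$. A word $\sigma\in[k]^n$ contains $\tau$ if there are indices $1\le i_1<\dots<i_m\le n$ such that for all $1\le a,b\le m$ and each relation $\phi\in\{<,=,>\}$, $\sigma(i_a)\,\phi\,\sigma(i_b)$ holds iff $\tau(a)\,\phi\,\tau(b)$ holds; otherwise $\sigma$ avoids $\tau$. $f_{112,221}(n,k)$ is the number of words in $[k]^n$ that avoid both $112$ and $221$. *)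

theory Defs
  imports Complex_Main
begin

definition words :: "nat \<Rightarrow> nat \<Rightarrow> nat list set" where
  "words k n = {\<sigma>. length \<sigma> = n \<and> set \<sigma> \<subseteq> {1..k}}"

(* The occurrence is given by the increasing map i from positions of \<tau> to positions of \<sigma>.
   Positions are counted from 0, as usual for lists. *)
definition contains_pattern :: "nat list \<Rightarrow> nat list \<Rightarrow> bool" where
  "contains_pattern \<sigma> \<tau> \<longleftrightarrow>
     (\<exists>i :: nat \<Rightarrow> nat.
        strict_mono_on {..<length \<tau>} i \<and>
        (\<forall>a < length \<tau>. i a < length \<sigma>) \<and>
        (\<forall>a < length \<tau>. \<forall>b < length \<tau>.
           (\<sigma> ! i a < \<sigma> ! i b \<longleftrightarrow> \<tau> ! a < \<tau> ! b) \<and>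
           (\<sigma> ! i a = \<sigma> ! i b \<longleftrightarrow> \<tau> ! a = \<tau> ! b) \<and>
           (\<sigma> ! i a > \<sigma> ! i b \<longleftrightarrow> \<tau> ! a > \<tau> ! b)))"

definition avoids_pattern :: "nat list \<Rightarrow> nat list \<Rightarrow> bool" where
  "avoids_pattern \<sigma> \<tau> \<longleftrightarrow> \<not> contains_pattern \<sigma> \<tau>"

definition avoid_count :: "nat list set \<Rightarrow> nat \<Rightarrow> nat \<Rightarrow> nat" where
  "avoid_count T n k = card {\<sigma> \<in> words k n. \<forall>\<tau>\<in>T. avoids_pattern \<sigma> \<tau>}"

end

(*
  A word avoids 112 and 221 iff every letter following a repetition x ... x equals x. Such a word
  has pairwise distinct letters, or it consists of j pairwise distinct letters followed by copies
  of one of them: the word with a repetition, of length n + 1, arises by repeating the last letter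
  of such a word of length n, or by appending to n distinct letters one of these n letters.
*)

theory Submission
  imports Defs
begin

definition constant_after_repetition :: "'a list \<Rightarrow> bool" where
  "constant_after_repetition \<sigma> \<longleftrightarrow>
     (\<forall>a b c. a < b \<longrightarrow> b < c \<longrightarrow> c < length \<sigma> \<longrightarrow> \<sigma> ! a = \<sigma> ! b \<longrightarrow> \<sigma> ! c = \<sigma> ! a)"

lemma all_less_3: "(\<forall>a < length [x, y, z]. P a) \<longleftrightarrow> P 0 \<and> P 1 \<and> P (2 :: nat)"
  by (auto simp: less_Suc_eq numeral_2_eq_2)

text \<open>An increasing map on three positions is the triple of its values. By trichotomy the
  relations \<open><\<close> and \<open>=\<close> on the pairs in increasing order determine all
  comparisons, so six equivalences suffice.\<close>

lemma contains_length_3_iff: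
  "contains_pattern \<sigma> [x, y, z] \<longleftrightarrow>
     (\<exists>a b c. a < b \<and> b < c \<and> c < length \<sigma> \<and>
        (\<sigma> ! a < \<sigma> ! b \<longleftrightarrow> x < y) \<and> (\<sigma> ! a = \<sigma> ! b \<longleftrightarrow> x = y) \<and>
        (\<sigma> ! a < \<sigma> ! c \<longleftrightarrow> x < z) \<and> (\<sigma> ! a = \<sigma> ! c \<longleftrightarrow> x = z) \<and>
        (\<sigma> ! b < \<sigma> ! c \<longleftrightarrow> y < z) \<and> (\<sigma> ! b = \<sigma> ! c \<longleftrightarrow> y = z))"
  (is "?L \<longleftrightarrow> (\<exists>a b c. ?R a b c)")
proof
  assume ?L
  then obtain i where i: "strict_mono_on {..<length [x, y, z]} i"
    and *: "\<forall>a < length [x, y, z]. i a < length \<sigma>"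
      "\<forall>a < length [x, y, z]. \<forall>b < length [x, y, z].
        (\<sigma> ! i a < \<sigma> ! i b \<longleftrightarrow> [x, y, z] ! a < [x, y, z] ! b) \<and>
        (\<sigma> ! i a = \<sigma> ! i b \<longleftrightarrow> [x, y, z] ! a = [x, y, z] ! b) \<and>
        (\<sigma> ! i a > \<sigma> ! i b \<longleftrightarrow> [x, y, z] ! a > [x, y, z] ! b)"
    unfolding contains_pattern_def by blast
  have "i 0 < i 1" "i 1 < i 2"
    by (rule strict_mono_onD[OF i]; simp)+
  then have "?R (i 0) (i 1) (i 2)"
    using * unfolding all_less_3 by simp
  then show "\<exists>a b c. ?R a b c" by blast
next
  assume "\<exists>a b c. ?R a b c"
  then obtain a b c where R: "?R a b c" by blast
  \<comment> \<open>The witness for the position map is the list \<open>[a, b, c]\<close> read as a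
    function of its index.\<close>
  have "strict_mono_on {..<length [x, y, z]} ((!) [a, b, c])"
    using R by (auto simp: strict_mono_on_def less_Suc_eq)
  moreover have "\<sigma> ! b < \<sigma> ! a \<longleftrightarrow> y < x" "\<sigma> ! c < \<sigma> ! a \<longleftrightarrow> z < x" "\<sigma> ! c < \<sigma> ! b \<longleftrightarrow> z < y"
    using R by (metis linorder_less_linear less_asym)+
  ultimately show ?L
    unfolding contains_pattern_def all_less_3
    using R by (intro exI[of _ "(!) [a, b, c]"]) (simp add: eq_commute)
qed

text \<open>112 is a repetition followed by a larger letter, 221 one followed by a smaller letter;
  excluding both leaves only equality. From here on the order of the letters is irrelevant.\<close>

lemma avoids_112_221_iff:
  "(\<forall>\<tau>\<in>{[1,1,2], [2,2,1]}. avoids_pattern \<sigma> \<tau>) \<longleftrightarrow> constant_after_repetition \<sigma>"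
proof -
  have "contains_pattern \<sigma> [1,1,2] \<longleftrightarrow>
      (\<exists>a b c. a < b \<and> b < c \<and> c < length \<sigma> \<and> \<sigma> ! a = \<sigma> ! b \<and> \<sigma> ! a < \<sigma> ! c)"
    unfolding contains_length_3_iff by (intro ex_cong1) auto
  moreover have "contains_pattern \<sigma> [2,2,1] \<longleftrightarrow>
      (\<exists>a b c. a < b \<and> b < c \<and> c < length \<sigma> \<and> \<sigma> ! a = \<sigma> ! b \<and> \<sigma> ! c < \<sigma> ! a)"
    unfolding contains_length_3_iff by (intro ex_cong1) auto
  moreover have "\<sigma> ! c = \<sigma> ! a \<longleftrightarrow> \<not> \<sigma> ! a < \<sigma> ! c \<and> \<not> \<sigma> ! c < \<sigma> ! a" for a c
    by auto
  ultimately show ?thesis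
    unfolding avoids_pattern_def constant_after_repetition_def by blast
qed

lemma distinct_imp_constant_after_repetition:
  "distinct \<sigma> \<Longrightarrow> constant_after_repetition \<sigma>"
  by (auto simp: constant_after_repetition_def nth_eq_iff_index_eq)

text \<open>This drives the recursion on the length. A new last letter is constrained only by a
  repetition inside \<sigma>, and then the last letter of \<sigma> already equals the repeated
  one.\<close>

lemma constant_after_repetition_snoc:
  "constant_after_repetition (\<sigma> @ [x]) \<longleftrightarrow>
     constant_after_repetition \<sigma> \<and> (distinct \<sigma> \<or> x = last \<sigma>)" (is "?L \<longleftrightarrow> ?R")
proof
  assume L: ?L
  have *: "(\<sigma> @ [x]) ! c = \<sigma> ! a"
    if "a < b" "b < c" "c \<le> length \<sigma>" "\<sigma> ! a = \<sigma> ! b" for a b c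
    using L[unfolded constant_after_repetition_def, rule_format, of a b c] that
    by (simp add: nth_append)
  have \<sigma>: "constant_after_repetition \<sigma>"
    unfolding constant_after_repetition_def
  proof (intro allI impI)
    fix a b c
    assume "a < b" "b < c" "c < length \<sigma>" "\<sigma> ! a = \<sigma> ! b"
    then show "\<sigma> ! c = \<sigma> ! a"
      using *[of a b c] by (simp add: nth_append)
  qed
  have "x = last \<sigma>" if rep: "\<not> distinct \<sigma>"
  proof -
    obtain a b where ab: "a < b" "b < length \<sigma>" "\<sigma> ! a = \<sigma> ! b"
      using rep unfolding distinct_conv_nth by (metis linorder_neqE_nat)
    \<comment> \<open>Either \<open>b\<close> is the last position of \<sigma>, or the last position
      comes after the repetition at \<open>a\<close>, \<open>b\<close>.\<close>
    then have "\<sigma> ! (length \<sigma> - 1) = \<sigma> ! a"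
      using \<sigma> by (cases "b = length \<sigma> - 1") (auto simp: constant_after_repetition_def)
    moreover have "x = \<sigma> ! a"
      using *[of a b "length \<sigma>"] ab by simp
    ultimately show ?thesis
      using ab by (metis last_conv_nth list.size(3) not_less_zero)
  qed
  then show ?R using \<sigma> by blast
next
  assume R: ?R
  show ?L
    unfolding constant_after_repetition_def
  proof (intro allI impI)
    fix a b c
    assume abc: "a < b" "b < c" "c < length (\<sigma> @ [x])" "(\<sigma> @ [x]) ! a = (\<sigma> @ [x]) ! b"
    then have ab: "b < length \<sigma>" "\<sigma> ! a = \<sigma> ! b"
      by (simp_all add: nth_append)
    show "(\<sigma> @ [x]) ! c = (\<sigma> @ [x]) ! a"
    proof (cases "c < length \<sigma>")
      case True
      then show ?thesis
        using R abc ab by (auto simp: nth_append constant_after_repetition_def)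
    next
      \<comment> \<open>Now \<open>c\<close> is the position of \<open>x\<close>. The repetition at
        \<open>a\<close>, \<open>b\<close> lies inside \<sigma>, so it fixes the last letter of
        \<sigma> and with it \<open>x\<close>.\<close>
      case False
      have "\<not> distinct \<sigma>"
        using ab \<open>a < b\<close> nth_eq_iff_index_eq[of \<sigma> a b] by auto
      then have "x = \<sigma> ! (length \<sigma> - 1)"
        using R ab by (metis last_conv_nth list.size(3) not_less_zero)
      moreover have "\<sigma> ! (length \<sigma> - 1) = \<sigma> ! a"
        using R ab \<open>a < b\<close>
        by (cases "b = length \<sigma> - 1") (auto simp: constant_after_repetition_def)
      ultimately show ?thesis
        using abc ab False by (simp add: nth_append)
    qed
  qed
qed

lemma finite_words: "finite (words k n)"
  using finite_lists_length_eq[of "{1..k}" n] by (simp add: words_def conj_commute)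

text \<open>Both sides are the falling factorial k(k-1)...(k-n+1), which for n > k is 0.\<close>

lemma card_distinct_words: "card {\<sigma> \<in> words k n. distinct \<sigma>} = fact n * (k choose n)"
proof (cases "n \<le> k")
  case True
  have "{\<sigma> \<in> words k n. distinct \<sigma>} = {\<sigma>. length \<sigma> = n \<and> distinct \<sigma> \<and> set \<sigma> \<subseteq> {1..k}}"
    by (auto simp: words_def)
  then have "card {\<sigma> \<in> words k n. distinct \<sigma>} = \<Prod>{k - n + 1..k}"
    using card_lists_distinct_length_eq[of "{1..k}" n] True by simp
  also have "\<dots> = fact k div fact (k - n)"
    by (simp add: fact_div_fact)
  also have "\<dots> = fact n * (k choose n)"
    using binomial_fact_lemma[OF True]
    by (metis fact_nonzero mult.assoc mult.commute nonzero_mult_div_cancel_right)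
  finally show ?thesis .
next
  case False
  \<comment> \<open>Pigeonhole: distinct letters from \<open>{1..k}\<close> number at most
    \<open>k\<close>.\<close>
  have "length \<sigma> \<le> k" if "distinct \<sigma>" "set \<sigma> \<subseteq> {1..k}" for \<sigma>
    using card_mono[OF _ that(2)] distinct_card[OF that(1)] by simp
  then have empty: "{\<sigma> \<in> words k n. distinct \<sigma>} = {}"
    using False by (auto simp: words_def)
  show ?thesis
    unfolding empty using False by simp
qed

definition repeating_words :: "nat \<Rightarrow> nat \<Rightarrow> nat list set" where
  "repeating_words k n = {\<sigma> \<in> words k n. \<not> distinct \<sigma> \<and> constant_after_repetition \<sigma>}"

text \<open>Split by whether the word without its last letter still has a repetition. If it does,
  the last letter is forced; if not, the last letter must create the repetition, so it is one of the
  earlier letters.\<close>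

lemma repeating_words_Suc:
  "repeating_words k (Suc n) =
     (\<lambda>\<sigma>. \<sigma> @ [last \<sigma>]) ` repeating_words k n \<union>
     (\<lambda>(\<sigma>, x). \<sigma> @ [x]) ` (SIGMA \<sigma>:{\<sigma> \<in> words k n. distinct \<sigma>}. set \<sigma>)"
  (is "_ = ?A \<union> ?B")
proof
  show "repeating_words k (Suc n) \<subseteq> ?A \<union> ?B"
  proof
    fix \<rho>
    assume \<rho>: "\<rho> \<in> repeating_words k (Suc n)"
    then obtain \<sigma> x where [simp]: "\<rho> = \<sigma> @ [x]"
      by (cases \<rho> rule: rev_cases) (auto simp: repeating_words_def words_def)
    show "\<rho> \<in> ?A \<union> ?B"
      using \<rho>
      by (cases "distinct \<sigma>")
        (auto simp: repeating_words_def words_def constant_after_repetition_snoc image_iff)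
  qed
next
  \<comment> \<open>A word with a repetition is nonempty, so its \<open>last\<close> is a genuine
    letter and appending it stays within \<open>{1..k}\<close>.\<close>
  have "last \<sigma> \<in> set \<sigma>" if "\<not> distinct \<sigma>" for \<sigma> :: "nat list"
    using that by (metis distinct.simps(1) last_in_set)
  moreover have "\<sigma> @ [x] \<in> words k (Suc n)" if "\<sigma> \<in> words k n" "x \<in> set \<sigma>" for \<sigma> x
    using that by (auto simp: words_def)
  ultimately show "?A \<union> ?B \<subseteq> repeating_words k (Suc n)"
    by (auto simp: repeating_words_def constant_after_repetition_snoc
        distinct_imp_constant_after_repetition)
qed

lemma card_repeating_words_Suc:
  "card (repeating_words k (Suc n)) = card (repeating_words k n) + n * fact n * (k choose n)"
proof -
  let ?D = "{\<sigma> \<in> words k n. distinct \<sigma>}"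
  have fin: "finite (repeating_words k n)" "finite ?D"
    using finite_words by (simp_all add: repeating_words_def)
  have "card (repeating_words k (Suc n)) =
      card ((\<lambda>\<sigma>. \<sigma> @ [last \<sigma>]) ` repeating_words k n) +
      card ((\<lambda>(\<sigma>, x). \<sigma> @ [x]) ` (SIGMA \<sigma>:?D. set \<sigma>))"
    \<comment> \<open>The two images are disjoint: removing the last letter leaves a word with a
      repetition in the first and a distinct word in the second.\<close>
    unfolding repeating_words_Suc
    using fin by (intro card_Un_disjoint) (auto simp: repeating_words_def)
  also have "card ((\<lambda>\<sigma>. \<sigma> @ [last \<sigma>]) ` repeating_words k n) = card (repeating_words k n)"
    by (intro card_image inj_onI) simp
  also have "card ((\<lambda>(\<sigma>, x). \<sigma> @ [x]) ` (SIGMA \<sigma>:?D. set \<sigma>)) = card (SIGMA \<sigma>:?D. set \<sigma>)"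
    by (intro card_image inj_onI) auto
  also have "\<dots> = (\<Sum>\<sigma>\<in>?D. card (set \<sigma>))"
    using fin by (intro card_SigmaI) auto
  also have "\<dots> = (\<Sum>\<sigma>\<in>?D. n)"
    \<comment> \<open>A distinct word of length \<open>n\<close> offers \<open>n\<close> letters to
      repeat.\<close>
    by (intro sum.cong) (auto simp: words_def distinct_card)
  also have "\<dots> = n * fact n * (k choose n)"
    by (simp add: card_distinct_words)
  finally show ?thesis .
qed

lemma card_repeating_words:
  "card (repeating_words k n) = (\<Sum>j = 1..n - 1. j * fact j * (k choose j))"
proof (induction n)
  case 0
  have "repeating_words k 0 = {}"
    by (auto simp: repeating_words_def words_def)
  then show ?case by simp
next
  case (Suc n)
  then show ?case
    \<comment> \<open>The split handles the truncated \<open>n - 1\<close>: for \<open>n = 0\<close>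
      the increment has the factor 0 and the sum stays empty; otherwise the increment is the new top
      term \<open>j = n\<close>.\<close>
    by (cases n) (simp_all add: card_repeating_words_Suc)
qed

text \<open>Avoiding words are counted as distinct or repeating. This one formula yields all three
  ranges of the theorem.\<close>

lemma avoid_count_112_221:
  "avoid_count {[1,1,2], [2,2,1]} n k =
     fact n * (k choose n) + (\<Sum>j = 1..n - 1. j * fact j * (k choose j))"
proof -
  have "{\<sigma> \<in> words k n. \<forall>\<tau>\<in>{[1,1,2], [2,2,1]}. avoids_pattern \<sigma> \<tau>} =
      {\<sigma> \<in> words k n. distinct \<sigma>} \<union> repeating_words k n"
    unfolding avoids_112_221_iff
    by (auto simp: repeating_words_def distinct_imp_constant_after_repetition)
  moreover have "card ({\<sigma> \<in> words k n. distinct \<sigma>} \<union> repeating_words k n) =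
      card {\<sigma> \<in> words k n. distinct \<sigma>} + card (repeating_words k n)"
    using finite_words by (intro card_Un_disjoint) (auto simp: repeating_words_def)
  ultimately show ?thesis
    unfolding avoid_count_def by (simp only: card_distinct_words card_repeating_words)
qed

theorem theorem9:
  shows "(\<forall>k n :: nat. n \<ge> k + 1 \<longrightarrow>
            avoid_count {[1,1,2], [2,2,1]} n k = (\<Sum>j = 1..k. j * fact j * (k choose j))) \<and>
         (\<forall>k n :: nat. k \<ge> n \<and> n \<ge> 2 \<longrightarrow>
            avoid_count {[1,1,2], [2,2,1]} n k =
              fact n * (k choose n) + (\<Sum>j = 1..n - 1. j * fact j * (k choose j))) \<and>
         (\<forall>k :: nat. avoid_count {[1,1,2], [2,2,1]} 0 k = 1 \<and>
                     avoid_count {[1,1,2], [2,2,1]} 1 k = k)"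
proof -
  \<comment> \<open>Since n - 1 \<ge> k, the longer range only adds terms with j > k, where
    \<open>k choose j\<close> is 0.\<close>
  have "(\<Sum>j = 1..n - 1. j * fact j * (k choose j)) = (\<Sum>j = 1..k. j * fact j * (k choose j))"
    if "n \<ge> k + 1" for k n :: nat
    using that by (intro sum.mono_neutral_right) auto
  then show ?thesis
    \<comment> \<open>For n > k the distinct words contribute 0. For \<open>n = 0\<close> and
      \<open>n = 1\<close> the sum is empty, leaving \<open>k choose 0\<close> and
      \<open>k choose 1\<close>.\<close>
    unfolding avoid_count_112_221 by simp
qed

end
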